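(* Consider the mixed clock ensemble, a weight vector $q\in\mathbb{R}^N$ with $q^\top \mathbb{1}_N=1$, the transformed state-space realization with observable state $\eta_o[k]$ and unobservable state $\eta_{\bar o}[k]$, and the full Kalman filter for this realization, all as defined in the context. Then the Kalman filtering algorithm for the transformed state-space realization is given, for all $k\ge 1$, by $$\begin{bmatrix}\hat\eta_o^-[k]\\ \hat\eta_{\bar o}^-[k]\end{bmatrix}=\begin{bmatrix}\mathbf{A}_{oo}&0\\ \mathbf{A}_{\bar oo}&A\end{bmatrix}\begin{bmatrix}\hat\eta_o[k-1]\\ \hat\eta_{\bar o}[k-1]\end{bmatrix}+\begin{bmatrix}\mathbf{B}_o\\ \mathbf{B}_{\bar o}\end{bmatrix}u[k-1],$$ $$\begin{bmatrix}P^-_{oo}[k]\\ P^-_{\bar oo}[k]\end{bmatrix}=\begin{bmatrix}\mathbf{A}_{oo}&0\\ \mathbf{A}_{\bar oo}&A\end{bmatrix}\begin{bmatrix}P_{oo}[k-1]\\ P_{\bar oo}[k-1]\end{bmatrix}\mathbf{A}_{oo}^\top+\begin{bmatrix}\mathbf{T}_oQ\mathbf{T}_o^\top\\ \mathbf{T}_{\bar o}Q\mathbf{T}_o^\top\end{bmatrix},$$ $$\begin{bmatrix}L_o[k]\\ L_{\bar o}[k]\end{bmatrix}=\begin{bmatrix}P^-_{oo}[k]\\ P^-_{\bar oo}[k]\end{bmatrix}\mathbf{C}_o^\top\left(\mathbf{C}_oP^-_{oo}[k]\mathbf{C}_o^\top+rI_{N-1}\right)^{-1},$$ $$\begin{bmatrix}P_{oo}[k]\\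 P_{\bar oo}[k]\end{bmatrix}=\begin{bmatrix}\left(I_{2(N-1)+M}-L_o[k]\mathbf{C}_o\right)P^-_{oo}[k]\\ P^-_{\bar oo}[k]\left(I_{2(N-1)+M}-\mathbf{C}_o^\top L_o[k]^\top\right)\end{bmatrix},$$ $$\begin{bmatrix}\hat\eta_o[k]\\ \hat\eta_{\bar o}[k]\end{bmatrix}=\begin{bmatrix}\hat\eta_o^-[k]\\ \hat\eta_{\bar o}^-[k]\end{bmatrix}+\begin{bmatrix}L_o[k]\\ L_{\bar o}[k]\end{bmatrix}\left(y[k]-\mathbf{C}_o\hat\eta_o^-[k]\right).$$ That is, the estimates, gains, and covariance blocks $P^-_{oo},P^-_{\bar oo},P_{oo},P_{\bar oo}$ produced by the full Kalman filter satisfy these recursions (in which the blocks $P^-_{\bar o\bar o}$ and $P_{\bar o\bar o}$ do not appear).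
   Context: Ensemble. $N$ clocks, of which the last $M$ ($0<M<N$) are hydrogen-maser-type (third order) and the first $N-M$ are cesium-type (second order). $\tau>0$ is the sampling interval. $\mathbb{1}_n$ is the all-ones column vector, $\otimes$ the Kronecker product. Let $$A=\begin{bmatrix}1&\tau\\ 0&1\end{bmatrix},\ \beta=\begin{bmatrix}\tau^2/2\\ \tau\end{bmatrix},\ B=\begin{bmatrix}\tau\\ 1\end{bmatrix},\ C=\begin{bmatrix}1&0\end{bmatrix},\ J=\begin{bmatrix}0_{(N-M)\times M}\\ I_M\end{bmatrix}.$$ The ensemble state is $x[k]=[p[k]^\top\ f[k]^\top]^\top\in\mathbb{R}^{2N}$ (phase deviations $p[k]\in\mathbb{R}^N$, frequency states $f[k]\in\mathbb{R}^N$) and $z[k]\in\mathbb{R}^M$ (frequency drifts), with input $u[k]\in\mathbb{R}^N$ and output $y[k]\in\mathbb{R}^{N-1}$: $$\begin{bmatrix}x[k+1]\\ z[k+1]\end{bmatrix}=\begin{bmatrix}A\otimes I_N&\beta\otimes J\\ 0&I_M\end{bmatrix}\begin{bmatrix}x[k]\\ z[k]\end{bmatrix}+\begin{bmatrix}B\otimes I_N\\ 0\end{bmatrix}u[k]+\begin{bmatrix}v^x[k]\\ v^z[k]\end{bmatrix},\quad y[k]=\begin{bmatrix}C\otimes V&0\end{bmatrix}\begin{bmatrix}x[k]\\ z[k]\end{bmatrix}+w[k],$$ where $V\in\mathbb{R}^{(N-1)\times N}$ satisfies $\ker V=\operatorname{im}\mathbb{1}_N$, $w$ is zero-mean white Gaussian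 noise with covariance $rI_{N-1}$, $r>0$, and the process noise $(v^x,v^z)$ is zero-mean white Gaussian with covariance $$Q=\begin{bmatrix}\tau\Sigma_1+\frac{\tau^3}{3}\Sigma_2+\frac{\tau^5}{20}\Sigma_3&\frac{\tau^2}{2}\Sigma_2+\frac{\tau^4}{8}\Sigma_3&\frac{\tau^3}{6}\Sigma_4\\ \frac{\tau^2}{2}\Sigma_2+\frac{\tau^4}{8}\Sigma_3&\tau\Sigma_2+\frac{\tau^3}{3}\Sigma_3&\frac{\tau^2}{2}\Sigma_4\\ \frac{\tau^3}{6}\Sigma_4^\top&\frac{\tau^2}{2}\Sigma_4^\top&\tau\Sigma_5\end{bmatrix},$$ with $\Sigma_1=\mathrm{diag}(\sigma_{1,1}^2,\dots,\sigma_{1,N}^2)$, $\Sigma_2=\mathrm{diag}(\sigma_{2,1}^2,\dots,\sigma_{2,N}^2)$, $\Sigma_5=\mathrm{diag}(\sigma_{3,N-M+1}^2,\dots,\sigma_{3,N}^2)$, $\Sigma_3=\mathrm{diag}(0_{(N-M)\times(N-M)},\Sigma_5)$, $\Sigma_4=\begin{bmatrix}0\\ \Sigma_5\end{bmatrix}\in\mathbb{R}^{N\times M}$. Transformation. Let $q\in\mathbb{R}^N$ with $q^\top\mathbb{1}_N=1$, and put $\mathbf{T}=\begin{bmatrix}\mathbf{T}_o\\ \mathbf{T}_{\bar o}\end{bmatrix}$ with $$\mathbf{T}_o=\begin{bmatrix}I_2\otimes V&0\\ 0&I_M\end{bmatrix},\qquad \mathbf{T}_{\bar o}=\begin{bmatrix}I_2\otimes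 q^\top&0_{2\times M}\end{bmatrix}.$$ $\mathbf{T}$ is invertible; set $\begin{bmatrix}\eta_o[k]\\ \eta_{\bar o}[k]\end{bmatrix}=\mathbf{T}\begin{bmatrix}x[k]\\ z[k]\end{bmatrix}$, with $\eta_o[k]\in\mathbb{R}^{2(N-1)+M}$ (observable state) and $\eta_{\bar o}[k]\in\mathbb{R}^2$ (unobservable state). The transformed realization is $$\begin{bmatrix}\eta_o[k+1]\\ \eta_{\bar o}[k+1]\end{bmatrix}=\begin{bmatrix}\mathbf{A}_{oo}&0\\ \mathbf{A}_{\bar oo}&A\end{bmatrix}\begin{bmatrix}\eta_o[k]\\ \eta_{\bar o}[k]\end{bmatrix}+\begin{bmatrix}\mathbf{B}_o\\ \mathbf{B}_{\bar o}\end{bmatrix}u[k]+\mathbf{T}\begin{bmatrix}v^x[k]\\ v^z[k]\end{bmatrix},\quad y[k]=\begin{bmatrix}\mathbf{C}_o&0\end{bmatrix}\begin{bmatrix}\eta_o[k]\\ \eta_{\bar o}[k]\end{bmatrix}+w[k],$$ $$\mathbf{A}_{oo}=\begin{bmatrix}A\otimes I_{N-1}&\beta\otimes VJ\\ 0&I_M\end{bmatrix},\ \mathbf{A}_{\bar oo}=\begin{bmatrix}0_{2\times2(N-1)}&\beta\otimes q^\top J\end{bmatrix},\ \mathbf{B}_o=\begin{bmatrix}B\otimes V\\ 0\end{bmatrix},\ \mathbf{B}_{\bar o}=B\otimes q^\top,\ \mathbf{C}_o=\begin{bmatrix}C\otimes I_{N-1}&0_{(N-1)\times M}\end{bmatrix}.$$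 Full Kalman filter for the transformed realization. Write $\breve A=\begin{bmatrix}\mathbf{A}_{oo}&0\\ \mathbf{A}_{\bar oo}&A\end{bmatrix}$, $\breve B=\begin{bmatrix}\mathbf{B}_o\\ \mathbf{B}_{\bar o}\end{bmatrix}$, $\breve C=\begin{bmatrix}\mathbf{C}_o&0\end{bmatrix}$, $\hat\eta=\begin{bmatrix}\hat\eta_o\\ \hat\eta_{\bar o}\end{bmatrix}$, $\hat\eta^-=\begin{bmatrix}\hat\eta^-_o\\ \hat\eta^-_{\bar o}\end{bmatrix}$. Starting from some $\hat\eta[0]$ and a symmetric positive semidefinite error covariance $\breve P[0]$, for $k\ge1$: $$\hat\eta^-[k]=\breve A\hat\eta[k-1]+\breve Bu[k-1],\quad \breve P^-[k]=\breve A\breve P[k-1]\breve A^\top+\mathbf{T}Q\mathbf{T}^\top,$$ $$\begin{bmatrix}L_o[k]\\ L_{\bar o}[k]\end{bmatrix}=\breve P^-[k]\breve C^\top(\breve C\breve P^-[k]\breve C^\top+rI_{N-1})^{-1},\quad \breve P[k]=\Big(I_{2N+M}-\begin{bmatrix}L_o[k]\\ L_{\bar o}[k]\end{bmatrix}\breve C\Big)\breve P^-[k],$$ $$\hat\eta[k]=\hat\eta^-[k]+\begin{bmatrix}L_o[k]\\ L_{\bar o}[k]\end{bmatrix}(y[k]-\breve C\hat\eta^-[k]).$$ The covariances are partitioned conformally as $$\breve P^-[k]=\begin{bmatrix}P^-_{oo}[k]&(P^-_{\bar oo}[k])^\top\\ P^-_{\bar oo}[k]&P^-_{\bar o\bar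 o}[k]\end{bmatrix},\quad \breve P[k]=\begin{bmatrix}P_{oo}[k]&P_{\bar oo}[k]^\top\\ P_{\bar oo}[k]&P_{\bar o\bar o}[k]\end{bmatrix}.$$ *)

theory Defs
  imports
    "HOL-Probability.Probability"
    "Jordan_Normal_Form.Gauss_Jordan_Elimination"
    "Jordan_Normal_Form.Matrix_Kernel"
begin

unbundle no inner_syntax
unbundle no vec_syntax

(* Matrices and vectors are those of Jordan_Normal_Form, with 0-based indices.  In names,
   the suffix b stands for the index "o-bar" (unobservable), so P_bo is the block (o-bar, o). *)

definition append_cols :: "'a::zero mat \<Rightarrow> 'a mat \<Rightarrow> 'a mat" (infixr "@\<^sub>c" 65) where
  "X @\<^sub>c Y = four_block_mat X Y (0\<^sub>m 0 (dim_col X)) (0\<^sub>m 0 (dim_col Y))"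

definition kronecker :: "'a::times mat \<Rightarrow> 'a mat \<Rightarrow> 'a mat" (infixl "\<otimes>\<^sub>k" 75) where
  "X \<otimes>\<^sub>k Y = Matrix.mat (dim_row X * dim_row Y) (dim_col X * dim_col Y)
     (\<lambda>(i, j). X $$ (i div dim_row Y, j div dim_col Y) * Y $$ (i mod dim_row Y, j mod dim_col Y))"

(* Unspecified for singular matrices; for invertible ones it is the two-sided inverse
   (fact mat_inverse of Gauss_Jordan_Elimination). *)
definition mat_inv :: "'a::field mat \<Rightarrow> 'a mat" where
  "mat_inv X = the (mat_inverse X)"

definition sym_psd :: "nat \<Rightarrow> real mat \<Rightarrow> bool" where
  "sym_psd n X \<longleftrightarrow> X \<in> carrier_mat n n \<and> transpose_mat X = X \<and>
     (\<forall>a\<in>carrier_vec n. 0 \<le> a \<bullet> (X *\<^sub>v a))"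

definition ones :: "nat \<Rightarrow> real vec" where
  "ones n = Matrix.vec n (\<lambda>_. 1)"

(* The law N(0, s), where s = 0 gives the point mass at 0: covariance matrices may be singular. *)
definition centered_normal :: "real \<Rightarrow> real measure" where
  "centered_normal s =
     (if s = 0 then return borel 0 else density lborel (\<lambda>t. ennreal (normal_density 0 (sqrt s) t)))"

(* A random vector is N(0, S) iff each linear form a in it is N(0, a^T S a).  The type of
   vectors of varying dimension carries no sigma-algebra, so independence over time is
   expressed through the coordinate functions. *)
definition white_gaussian ::
  "'w measure \<Rightarrow> nat \<Rightarrow> real mat \<Rightarrow> (nat \<Rightarrow> 'w \<Rightarrow> real vec) \<Rightarrow> bool" where
  "white_gaussian \<Omega> n S \<xi> \<longleftrightarrow>
     (\<forall>k. \<forall>\<omega>\<in>space \<Omega>. \<xi> k \<omega> \<in> carrier_vec n) \<and>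
     prob_space.indep_vars \<Omega> (\<lambda>_. PiM {..<n} (\<lambda>_. borel))
       (\<lambda>k \<omega>. \<lambda>i\<in>{..<n}. \<xi> k \<omega> $ i) UNIV \<and>
     (\<forall>k. \<forall>a\<in>carrier_vec n.
        distr \<Omega> borel (\<lambda>\<omega>. a \<bullet> \<xi> k \<omega>) = centered_normal (a \<bullet> (S *\<^sub>v a)))"

definition clock_A :: "real \<Rightarrow> real mat" where
  "clock_A \<tau> = mat_of_rows_list 2 [[1, \<tau>], [0, 1]]"

definition clock_beta :: "real \<Rightarrow> real mat" where
  "clock_beta \<tau> = mat_of_rows_list 1 [[\<tau>\<^sup>2 / 2], [\<tau>]]"

definition clock_B :: "real \<Rightarrow> real mat" where
  "clock_B \<tau> = mat_of_rows_list 1 [[\<tau>], [1]]"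

definition clock_C :: "real mat" where
  "clock_C = mat_of_rows_list 2 [[1, 0]]"

definition clock_J :: "nat \<Rightarrow> nat \<Rightarrow> real mat" where
  "clock_J N M = 0\<^sub>m (N - M) M @\<^sub>r 1\<^sub>m M"

definition ens_A :: "nat \<Rightarrow> nat \<Rightarrow> real \<Rightarrow> real mat" where
  "ens_A N M \<tau> = four_block_mat
     (clock_A \<tau> \<otimes>\<^sub>k 1\<^sub>m N) (clock_beta \<tau> \<otimes>\<^sub>k clock_J N M)
     (0\<^sub>m M (2 * N))       (1\<^sub>m M)"

definition ens_B :: "nat \<Rightarrow> nat \<Rightarrow> real \<Rightarrow> real mat" where
  "ens_B N M \<tau> = (clock_B \<tau> \<otimes>\<^sub>k 1\<^sub>m N) @\<^sub>r 0\<^sub>m M N"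

definition ens_C :: "nat \<Rightarrow> nat \<Rightarrow> real mat \<Rightarrow> real mat" where
  "ens_C N M V = (clock_C \<otimes>\<^sub>k V) @\<^sub>c 0\<^sub>m (N - 1) M"

(* The families s1, s2, s3 of standard deviations are indexed by the clock numbers 1, ..., N. *)
definition Sigma_diag :: "nat \<Rightarrow> (nat \<Rightarrow> real) \<Rightarrow> real mat" where
  "Sigma_diag N s = mat_diag N (\<lambda>i. (s (i + 1))\<^sup>2)"

definition Sigma5 :: "nat \<Rightarrow> nat \<Rightarrow> (nat \<Rightarrow> real) \<Rightarrow> real mat" where
  "Sigma5 N M s3 = mat_diag M (\<lambda>i. (s3 (N - M + i + 1))\<^sup>2)"

definition Sigma3 :: "nat \<Rightarrow> nat \<Rightarrow> (nat \<Rightarrow> real) \<Rightarrow> real mat" where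
  "Sigma3 N M s3 = four_block_mat
     (0\<^sub>m (N - M) (N - M)) (0\<^sub>m (N - M) M)
     (0\<^sub>m M (N - M))       (Sigma5 N M s3)"

definition Sigma4 :: "nat \<Rightarrow> nat \<Rightarrow> (nat \<Rightarrow> real) \<Rightarrow> real mat" where
  "Sigma4 N M s3 = 0\<^sub>m (N - M) M @\<^sub>r Sigma5 N M s3"

definition ens_Q ::
  "nat \<Rightarrow> nat \<Rightarrow> real \<Rightarrow> (nat \<Rightarrow> real) \<Rightarrow> (nat \<Rightarrow> real) \<Rightarrow> (nat \<Rightarrow> real) \<Rightarrow> real mat" where
  "ens_Q N M \<tau> s1 s2 s3 =
     (let S1 = Sigma_diag N s1; S2 = Sigma_diag N s2; S3 = Sigma3 N M s3;
          S4 = Sigma4 N M s3; S5 = Sigma5 N M s3;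
          Q11 = \<tau> \<cdot>\<^sub>m S1 + (\<tau> ^ 3 / 3) \<cdot>\<^sub>m S2 + (\<tau> ^ 5 / 20) \<cdot>\<^sub>m S3;
          Q12 = (\<tau>\<^sup>2 / 2) \<cdot>\<^sub>m S2 + (\<tau> ^ 4 / 8) \<cdot>\<^sub>m S3;
          Q22 = \<tau> \<cdot>\<^sub>m S2 + (\<tau> ^ 3 / 3) \<cdot>\<^sub>m S3
      in four_block_mat
           (four_block_mat Q11 Q12 Q12 Q22)
           ((\<tau> ^ 3 / 6) \<cdot>\<^sub>m S4 @\<^sub>r (\<tau>\<^sup>2 / 2) \<cdot>\<^sub>m S4)
           ((\<tau> ^ 3 / 6) \<cdot>\<^sub>m transpose_mat S4 @\<^sub>c (\<tau>\<^sup>2 / 2) \<cdot>\<^sub>m transpose_mat S4)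
           (\<tau> \<cdot>\<^sub>m S5))"

definition T_o :: "nat \<Rightarrow> nat \<Rightarrow> real mat \<Rightarrow> real mat" where
  "T_o N M V = four_block_mat
     (1\<^sub>m 2 \<otimes>\<^sub>k V)   (0\<^sub>m (2 * (N - 1)) M)
     (0\<^sub>m M (2 * N)) (1\<^sub>m M)"

definition T_b :: "nat \<Rightarrow> real vec \<Rightarrow> real mat" where
  "T_b M q = (1\<^sub>m 2 \<otimes>\<^sub>k mat_of_row q) @\<^sub>c 0\<^sub>m 2 M"

definition T_full :: "nat \<Rightarrow> nat \<Rightarrow> real mat \<Rightarrow> real vec \<Rightarrow> real mat" where
  "T_full N M V q = T_o N M V @\<^sub>r T_b M q"

definition A_oo :: "nat \<Rightarrow> nat \<Rightarrow> real \<Rightarrow> real mat \<Rightarrow> real mat" where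
  "A_oo N M \<tau> V = four_block_mat
     (clock_A \<tau> \<otimes>\<^sub>k 1\<^sub>m (N - 1)) (clock_beta \<tau> \<otimes>\<^sub>k (V * clock_J N M))
     (0\<^sub>m M (2 * (N - 1)))      (1\<^sub>m M)"

definition A_bo :: "nat \<Rightarrow> nat \<Rightarrow> real \<Rightarrow> real vec \<Rightarrow> real mat" where
  "A_bo N M \<tau> q = 0\<^sub>m 2 (2 * (N - 1)) @\<^sub>c (clock_beta \<tau> \<otimes>\<^sub>k (mat_of_row q * clock_J N M))"

definition B_o :: "nat \<Rightarrow> nat \<Rightarrow> real \<Rightarrow> real mat \<Rightarrow> real mat" where
  "B_o N M \<tau> V = (clock_B \<tau> \<otimes>\<^sub>k V) @\<^sub>r 0\<^sub>m M N"

definition B_b :: "real \<Rightarrow> real vec \<Rightarrow> real mat" where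
  "B_b \<tau> q = clock_B \<tau> \<otimes>\<^sub>k mat_of_row q"

definition C_o :: "nat \<Rightarrow> nat \<Rightarrow> real mat" where
  "C_o N M = (clock_C \<otimes>\<^sub>k 1\<^sub>m (N - 1)) @\<^sub>c 0\<^sub>m (N - 1) M"

definition A_full :: "nat \<Rightarrow> nat \<Rightarrow> real \<Rightarrow> real mat \<Rightarrow> real vec \<Rightarrow> real mat" where
  "A_full N M \<tau> V q = four_block_mat
     (A_oo N M \<tau> V) (0\<^sub>m (2 * (N - 1) + M) 2)
     (A_bo N M \<tau> q) (clock_A \<tau>)"

definition B_full :: "nat \<Rightarrow> nat \<Rightarrow> real \<Rightarrow> real mat \<Rightarrow> real vec \<Rightarrow> real mat" where
  "B_full N M \<tau> V q = B_o N M \<tau> V @\<^sub>r B_b \<tau> q"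

definition C_full :: "nat \<Rightarrow> nat \<Rightarrow> real mat" where
  "C_full N M = C_o N M @\<^sub>c 0\<^sub>m (N - 1) 2"

(* F, G, H: transition, input and output matrix; W, R: process and measurement noise
   covariance.  The initial values e 0 and P 0 are free; em, Pm and L are constrained
   only from time 1 on. *)
definition kalman_filter ::
  "real mat \<Rightarrow> real mat \<Rightarrow> real mat \<Rightarrow> real mat \<Rightarrow> real mat \<Rightarrow>
   (nat \<Rightarrow> real vec) \<Rightarrow> (nat \<Rightarrow> real vec) \<Rightarrow>
   (nat \<Rightarrow> real vec) \<Rightarrow> (nat \<Rightarrow> real vec) \<Rightarrow>
   (nat \<Rightarrow> real mat) \<Rightarrow> (nat \<Rightarrow> real mat) \<Rightarrow> (nat \<Rightarrow> real mat) \<Rightarrow> bool" where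
  "kalman_filter F G H W R u y em e Pm P L \<longleftrightarrow>
     (\<forall>k\<ge>1.
        em k = F *\<^sub>v e (k - 1) + G *\<^sub>v u (k - 1) \<and>
        Pm k = F * P (k - 1) * transpose_mat F + W \<and>
        L k = Pm k * transpose_mat H * mat_inv (H * Pm k * transpose_mat H + R) \<and>
        P k = (1\<^sub>m (dim_row F) - L k * H) * Pm k \<and>
        e k = em k + L k *\<^sub>v (y k - H *\<^sub>v em k))"

end

theory Submission
  imports Defs
begin

text \<open>Post-multiplication by \<open>E = 1\<^sub>m n @\<^sub>r 0\<^sub>m m n\<close> extracts the first block column of a covariance, and
  the observable part is invariant: \<open>F\<^sup>T * E = E * Aoo\<^sup>T\<close> and \<open>H\<^sup>T = E * Co\<^sup>T\<close>.  Hence the first block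
  column of the Riccati recursion involves no other block.  The two forms of the update of the
  lower block agree because the innovation covariance is symmetric and invertible, which
  requires the positive semidefiniteness of all covariances (Joseph form) and of \<open>Q\<close>.\<close>

subsection \<open>Stacked blocks\<close>

text \<open>The obstacle is the lower block of the covariance update. Read off the full filter it is
  \<open>Pm_bo - L_b Co Pm_oo\<close>, whereas the claim is \<open>Pm_bo (I - Co^T L_o^T)\<close>,
  in which \<open>L_b\<close> is absent. Comparing the two needs the gain equation
  \<open>L S = Pm H^T\<close> for the innovation covariance \<open>S\<close>, hence a genuine
  inverse of \<open>S\<close> at every time, while \<open>mat_inv\<close> says nothing about
  singular matrices. Since \<open>S\<close> is \<open>H Pm H^T + r I\<close> with r > 0, it is
  enough that \<open>Pm\<close> is positive semidefinite. This has to be carried along the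
  recursion, where two places are not evident: the update \<open>(I - L H) Pm\<close> is not visibly
  symmetric, let alone semidefinite, and the prediction adds a congruence of \<open>Q\<close>, whose
  semidefiniteness is not a matter of its single blocks. The latter is read off its entries, which
  are integrals over one sampling interval.\<close>

lemma transpose_append_rows:
  assumes "X \<in> carrier_mat n1 m" "Y \<in> carrier_mat n2 m"
  shows "transpose_mat (X @\<^sub>r Y) = transpose_mat X @\<^sub>c transpose_mat Y"
  using assms by (intro eq_matI) (auto simp: append_rows_def append_cols_def)

lemma append_cols_carrier:
  assumes "X \<in> carrier_mat n m1" "Y \<in> carrier_mat n m2"
  shows "X @\<^sub>c Y \<in> carrier_mat n (m1 + m2)"
  using assms by (auto simp: append_cols_def)

lemma transpose_append_cols:
  assumes "X \<in> carrier_mat n m1" "Y \<in> carrier_mat n m2"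
  shows "transpose_mat (X @\<^sub>c Y) = transpose_mat X @\<^sub>r transpose_mat Y"
  using assms by (intro eq_matI) (auto simp: append_rows_def append_cols_def)

lemma append_rows_mult:
  fixes X :: "'a::semiring_0 mat"
  assumes "X \<in> carrier_mat n1 m" "Y \<in> carrier_mat n2 m" "Z \<in> carrier_mat m k"
  shows "(X @\<^sub>r Y) * Z = X * Z @\<^sub>r Y * Z"
  using assms by (intro eq_matI) (auto simp: append_rows_def scalar_prod_def)

text \<open>Blocks with zero rows or zero columns complete both factors to four blocks, so this is
  an instance of block multiplication.\<close>

lemma append_cols_mult_append_rows:
  fixes X1 :: "'a::semiring_0 mat"
  assumes "X1 \<in> carrier_mat n m1" "X2 \<in> carrier_mat n m2"
    and "Y1 \<in> carrier_mat m1 k" "Y2 \<in> carrier_mat m2 k"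
  shows "(X1 @\<^sub>c X2) * (Y1 @\<^sub>r Y2) = X1 * Y1 + X2 * Y2"
  using mult_four_block_mat[of X1 n m1 X2 m2 "0\<^sub>m 0 m1" 0 "0\<^sub>m 0 m2" Y1 k "0\<^sub>m m1 0" 0 Y2 "0\<^sub>m m2 0"] assms
  by (intro eq_matI) (auto simp: append_cols_def append_rows_def)

lemma append_cols_mult_append_vec:
  fixes X1 :: "'a::semiring_0 mat"
  assumes "X1 \<in> carrier_mat n m1" "X2 \<in> carrier_mat n m2"
    and "v1 \<in> carrier_vec m1" "v2 \<in> carrier_vec m2"
  shows "(X1 @\<^sub>c X2) *\<^sub>v (v1 @\<^sub>v v2) = X1 *\<^sub>v v1 + X2 *\<^sub>v v2"
  using four_block_mat_mult_vec[of X1 n m1 X2 m2 "0\<^sub>m 0 m1" 0 "0\<^sub>m 0 m2" v1 v2] assms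
  by (intro eq_vecI) (auto simp: append_cols_def)

lemma append_rows_minus:
  assumes "X \<in> carrier_mat n1 m" "Y \<in> carrier_mat n2 m"
    and "X' \<in> carrier_mat n1 m" "Y' \<in> carrier_mat n2 m"
  shows "(X @\<^sub>r Y) - (X' @\<^sub>r Y') = (X - X') @\<^sub>r (Y - Y')"
  using assms by (intro eq_matI) (auto simp: append_rows_def)

text \<open>This splits the gain equation of the full filter into an upper and a lower equation.
  Cancellation works because both sides are cut at the same height \<open>n1\<close>.\<close>

lemma append_rows_inject:
  assumes "X \<in> carrier_mat n1 m" "Y \<in> carrier_mat n2 m"
    and "X' \<in> carrier_mat n1 m" "Y' \<in> carrier_mat n2 m"
    and eq: "X @\<^sub>r Y = X' @\<^sub>r Y'"
  shows "X = X'" "Y = Y'"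
proof -
  have *: "(X @\<^sub>r Y) $$ (i, j) = (X' @\<^sub>r Y') $$ (i, j)" for i j
    by (simp add: eq)
  show "X = X'"
  proof (rule eq_matI)
    show "X $$ (i, j) = X' $$ (i, j)" if "i < dim_row X'" "j < dim_col X'" for i j
      using *[of i j] that assms(1-4) by (auto simp: append_rows_def)
  qed (use assms in auto)
  show "Y = Y'"
  proof (rule eq_matI)
    show "Y $$ (i, j) = Y' $$ (i, j)" if "i < dim_row Y'" "j < dim_col Y'" for i j
      using *[of "n1 + i" j] that assms(1-4) by (auto simp: append_rows_def)
  qed (use assms in auto)
qed

text \<open>Once the selection of blocks is a matrix factor, associativity can move it through the
  products of the recursion.\<close>

lemma split_block_first_columns:
  fixes X :: "'a::semiring_1 mat"
  assumes X: "X \<in> carrier_mat (n + m) (n + m)"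
    and split: "split_block X n n = (X11, X12, X21, X22)"
  shows "X * (1\<^sub>m n @\<^sub>r 0\<^sub>m m n) = X11 @\<^sub>r X21"
proof -
  note c = split_block[OF split, of m m]
  have "X = (X11 @\<^sub>c X12) @\<^sub>r (X21 @\<^sub>c X22)"
    using X c by (intro eq_matI) (auto simp: append_rows_def append_cols_def)
  then show ?thesis
    using X c(1-4)
    by (simp add: append_rows_mult[of _ n "n + m" _ m _ n] append_cols_carrier
        append_cols_mult_append_rows[of _ _ n _ m _ n])
qed

lemma split_block_symmetric:
  assumes X: "X \<in> carrier_mat (n + m) (n + m)" and sym: "transpose_mat X = X"
    and split: "split_block X n n = (X11, X12, X21, X22)"
  shows "X12 = transpose_mat X21" "transpose_mat X11 = X11"
proof -
  have "X $$ (i, j) = X $$ (j, i)" if "i < n + m" "j < n + m" for i j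
    using X that by (subst sym[symmetric]) auto
  then show "X12 = transpose_mat X21" "transpose_mat X11 = X11"
    using X split by (auto simp: split_block_def Let_def)
qed

subsection \<open>Positive semidefinite matrices\<close>

lemma sym_psdD:
  assumes "sym_psd n X"
  shows "X \<in> carrier_mat n n" "transpose_mat X = X"
    "\<And>a. a \<in> carrier_vec n \<Longrightarrow> 0 \<le> a \<bullet> (X *\<^sub>v a)"
  using assms by (auto simp: sym_psd_def)

lemma sym_psd_add:
  assumes "sym_psd n X" "sym_psd n Y"
  shows "sym_psd n (X + Y)"
  using assms
  by (auto simp: sym_psd_def transpose_add[of _ n n] add_mult_distrib_mat_vec[of _ n n]
      scalar_prod_add_distrib[of _ n])

text \<open>The form at \<open>a\<close> is the form of \<open>X\<close> at \<open>F^T a\<close>. As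
  \<open>F\<close> may be rectangular, this serves the transition, the output, the change of
  coordinates and the gain alike.\<close>

lemma sym_psd_congruence:
  assumes X: "sym_psd n X" and F: "F \<in> carrier_mat m n"
  shows "sym_psd m (F * X * transpose_mat F)"
  unfolding sym_psd_def
proof (intro conjI ballI)
  note c = sym_psdD[OF X] F
  show "F * X * transpose_mat F \<in> carrier_mat m m"
    using c by auto
  show "transpose_mat (F * X * transpose_mat F) = F * X * transpose_mat F"
    using c by (simp add: transpose_mult[of F m n _ m] transpose_mult[of X n n _ m])
  fix a :: "real vec" assume a: "a \<in> carrier_vec m"
  define b where "b = transpose_mat F *\<^sub>v a"
  have b: "b \<in> carrier_vec n"
    using a F by (auto simp: b_def)
  have "a \<bullet> ((F * X * transpose_mat F) *\<^sub>v a) = a \<bullet> (F *\<^sub>v (X *\<^sub>v b))"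
    using a c by (simp add: b_def assoc_mult_mat_vec[of _ m n _ m] assoc_mult_mat_vec[of _ m n _ n])
  also have "\<dots> = b \<bullet> (X *\<^sub>v b)"
    unfolding b_def using a b c
    by (subst transpose_vec_mult_scalar[of F m n]) (auto simp: b_def)
  finally show "0 \<le> a \<bullet> ((F * X * transpose_mat F) *\<^sub>v a)"
    using c(3) b by simp
qed

lemma scalar_prod_self:
  fixes a :: "real vec"
  assumes "a \<in> carrier_vec n"
  shows "a \<bullet> a = (\<Sum>i<n. (a $ i)\<^sup>2)"
  using assms by (simp add: scalar_prod_def power2_eq_square atLeast0LessThan)

lemma sym_psd_scaled_one:
  assumes "0 \<le> r" shows "sym_psd n (r \<cdot>\<^sub>m 1\<^sub>m n)"
proof -
  have "transpose_mat (r \<cdot>\<^sub>m 1\<^sub>m n) = r \<cdot>\<^sub>m 1\<^sub>m n"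
    by (intro eq_matI) auto
  moreover have "a \<bullet> ((r \<cdot>\<^sub>m 1\<^sub>m n) *\<^sub>v a) = r * (a \<bullet> a)" if "a \<in> carrier_vec n" for a
  proof -
    have "(r \<cdot>\<^sub>m 1\<^sub>m n) *\<^sub>v a = r \<cdot>\<^sub>v a" using that by (intro eq_vecI) auto
    then show ?thesis using that by simp
  qed
  ultimately show ?thesis
    using assms by (auto simp: sym_psd_def scalar_prod_self sum_nonneg)
qed

text \<open>A trivial kernel gives a nonzero determinant, so \<open>mat_inverse\<close> returns
  \<open>Some\<close> and the selector \<open>the\<close> in \<open>mat_inv\<close> has a defined
  value.\<close>

lemma mat_inv_inverts:
  fixes X :: "'a::field mat"
  assumes X: "X \<in> carrier_mat n n"
    and ker: "\<And>v. v \<in> carrier_vec n \<Longrightarrow> X *\<^sub>v v = 0\<^sub>v n \<Longrightarrow> v = 0\<^sub>v n"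
  shows "mat_inv X \<in> carrier_mat n n" "mat_inv X * X = 1\<^sub>m n"
proof -
  have "det X \<noteq> 0"
    using det_0_iff_vec_prod_zero_field[OF X] ker by auto
  then have "X \<in> Units (ring_mat TYPE('a) n ())"
    using det_non_zero_imp_unit[OF X] by simp
  then obtain Y where "mat_inverse X = Some Y"
    using mat_inverse(1)[OF X, of "()"] by auto
  then show "mat_inv X \<in> carrier_mat n n" "mat_inv X * X = 1\<^sub>m n"
    using mat_inverse(2)[OF X, of Y] by (auto simp: mat_inv_def)
qed

text \<open>For \<open>v\<close> in the kernel, the form of \<open>X\<close> at \<open>v\<close> and
  r times the squared length of \<open>v\<close> add up to 0. The first is nonnegative and r is
  positive, so the length vanishes.\<close>

lemma mat_inv_psd_plus_scaled_one:
  assumes X: "sym_psd n X" and r: "0 < r"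
  shows "mat_inv (X + r \<cdot>\<^sub>m 1\<^sub>m n) \<in> carrier_mat n n"
    "mat_inv (X + r \<cdot>\<^sub>m 1\<^sub>m n) * (X + r \<cdot>\<^sub>m 1\<^sub>m n) = 1\<^sub>m n"
proof -
  note c = sym_psdD[OF X]
  have S: "X + r \<cdot>\<^sub>m 1\<^sub>m n \<in> carrier_mat n n"
    using c by auto
  have "v = 0\<^sub>v n" if v: "v \<in> carrier_vec n" and eq: "(X + r \<cdot>\<^sub>m 1\<^sub>m n) *\<^sub>v v = 0\<^sub>v n" for v
  proof -
    have "(r \<cdot>\<^sub>m 1\<^sub>m n) *\<^sub>v v = r \<cdot>\<^sub>v v"
      using v by (intro eq_vecI) auto
    then have "v \<bullet> (X *\<^sub>v v) + r * (v \<bullet> v) = v \<bullet> ((X + r \<cdot>\<^sub>m 1\<^sub>m n) *\<^sub>v v)"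
      using v c by (simp add: add_mult_distrib_mat_vec[of _ n n] scalar_prod_add_distrib[of _ n])
    also have "\<dots> = 0"
      using v by (simp add: eq)
    finally have "r * (v \<bullet> v) \<le> 0"
      using c(3)[OF v] by simp
    with r have "v \<bullet> v \<le> 0"
      by (simp add: mult_le_0_iff)
    then have "(\<Sum>i<n. (v $ i)\<^sup>2) \<le> 0"
      using v by (simp add: scalar_prod_self)
    then have "(\<Sum>i<n. (v $ i)\<^sup>2) = 0"
      by (intro antisym sum_nonneg) auto
    then show ?thesis
      using v by (intro eq_vecI) (auto simp: sum_nonneg_eq_0_iff)
  qed
  from mat_inv_inverts[OF S this]
  show "mat_inv (X + r \<cdot>\<^sub>m 1\<^sub>m n) \<in> carrier_mat n n"
    "mat_inv (X + r \<cdot>\<^sub>m 1\<^sub>m n) * (X + r \<cdot>\<^sub>m 1\<^sub>m n) = 1\<^sub>m n" by auto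
qed

subsection \<open>Covariances of the Kalman filter\<close>

text \<open>With \<open>K = I - L H\<close>, the gain equation says exactly that
  \<open>K P H^T = L R\<close>. The term \<open>K P H^T L^T\<close> by which \<open>K P\<close>
  exceeds \<open>K P K^T\<close> is therefore \<open>L R L^T\<close>.\<close>

lemma kalman_update_joseph:
  fixes P :: "'a::comm_ring_1 mat"
  assumes P: "P \<in> carrier_mat n n" and R: "R \<in> carrier_mat m m"
    and H: "H \<in> carrier_mat m n" and L: "L \<in> carrier_mat n m"
    and gain: "L * (H * P * transpose_mat H + R) = P * transpose_mat H"
  shows "(1\<^sub>m n - L * H) * P =
    (1\<^sub>m n - L * H) * P * transpose_mat (1\<^sub>m n - L * H) + L * R * transpose_mat L"
proof -
  let ?K = "1\<^sub>m n - L * H"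
  note c = P R H L
  have K: "?K \<in> carrier_mat n n"
    using c by auto
  have "?K * (P * transpose_mat H) = P * transpose_mat H - L * (H * P * transpose_mat H)"
    using c by (simp add: minus_mult_distrib_mat[of _ n n _ _ m]
        assoc_mult_mat[of L n m H n "P * transpose_mat H" m])
  also have "\<dots> = L * (H * P * transpose_mat H) + L * R - L * (H * P * transpose_mat H)"
    using c by (subst gain[symmetric], subst mult_add_distrib_mat[of _ n m _ m]) auto
  also have "\<dots> = L * R"
    using c by (intro eq_matI) auto
  finally have KPH: "?K * (P * transpose_mat H) = L * R" .
  have "transpose_mat ?K = 1\<^sub>m n - transpose_mat H * transpose_mat L"
    using c by (simp add: transpose_minus[of _ n n] transpose_mult[of _ n m _ n])
  then have "?K * P * transpose_mat ?K =
      ?K * P - ?K * P * (transpose_mat H * transpose_mat L)"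
    using c K by (simp add: mult_minus_distrib_mat[of "?K * P" n n "1\<^sub>m n" n] del: assoc_mult_mat)
  also have "?K * P * (transpose_mat H * transpose_mat L) = ?K * (P * transpose_mat H) * transpose_mat L"
    using c by (simp add: assoc_mult_mat[OF K P, of _ n] assoc_mult_mat[OF K, of _ m _ n])
  also have "\<dots> = L * R * transpose_mat L"
    by (simp only: KPH)
  finally have "?K * P * transpose_mat ?K = ?K * P - L * R * transpose_mat L" .
  then show ?thesis
    using c K by (intro eq_matI) (auto simp del: assoc_mult_mat)
qed

text \<open>The Joseph form is a sum of two congruences, one of \<open>P\<close> and one of
  \<open>R\<close>, so symmetry and semidefiniteness are both inherited.\<close>

lemma sym_psd_kalman_update:
  assumes "sym_psd n P" "sym_psd m R"
    and "H \<in> carrier_mat m n" "L \<in> carrier_mat n m"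
    and "L * (H * P * transpose_mat H + R) = P * transpose_mat H"
  shows "sym_psd n ((1\<^sub>m n - L * H) * P)"
proof -
  have "1\<^sub>m n - L * H \<in> carrier_mat n n"
    using assms(3,4) by auto
  then show ?thesis
    by (subst kalman_update_joseph[OF sym_psdD(1)[OF assms(1)] sym_psdD(1)[OF assms(2)] assms(3-5)])
      (rule sym_psd_add[OF sym_psd_congruence[OF assms(1)] sym_psd_congruence[OF assms(2,4)]])
qed

text \<open>Here the inverse is traded for an equation without one. Both the Joseph form and the
  comparison of the lower blocks start from this equation.\<close>

lemma kalman_gain_equation:
  assumes Pm: "sym_psd n Pm" and H: "H \<in> carrier_mat m n" and r: "0 < r"
  defines "S \<equiv> H * Pm * transpose_mat H + r \<cdot>\<^sub>m 1\<^sub>m m"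
  shows "Pm * transpose_mat H * mat_inv S \<in> carrier_mat n m"
    "Pm * transpose_mat H * mat_inv S * S = Pm * transpose_mat H"
proof -
  note c = sym_psdD(1)[OF Pm] H
  note inv = mat_inv_psd_plus_scaled_one[OF sym_psd_congruence[OF Pm H] r, folded S_def]
  have S: "S \<in> carrier_mat m m"
    using c by (auto simp: S_def)
  show "Pm * transpose_mat H * mat_inv S \<in> carrier_mat n m"
    using c inv(1) by auto
  show "Pm * transpose_mat H * mat_inv S * S = Pm * transpose_mat H"
    using c inv S by (subst assoc_mult_mat[of "Pm * transpose_mat H" n m]) auto
qed

text \<open>The induction runs on \<open>P\<close>, because \<open>Pm\<close> is constrained only
  from time 1 on. Each step passes through \<open>Pm (Suc k)\<close>, whose semidefiniteness is what
  makes the gain at that time meaningful.\<close>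

lemma kalman_covariances_psd:
  assumes filter: "kalman_filter F G H W (r \<cdot>\<^sub>m 1\<^sub>m m) u y em e Pm P L"
    and F: "F \<in> carrier_mat n n" and H: "H \<in> carrier_mat m n"
    and W: "sym_psd n W" and r: "0 < r" and P0: "sym_psd n (P 0)"
  shows "sym_psd n (P k)" "1 \<le> k \<Longrightarrow> sym_psd n (Pm k)"
proof -
  have predict: "sym_psd n (Pm k)" if "1 \<le> k" "sym_psd n (P (k - 1))" for k
    using filter that sym_psd_add[OF sym_psd_congruence[OF that(2) F] W]
    by (simp add: kalman_filter_def del: assoc_mult_mat)
  have P: "sym_psd n (P k)" for k
  proof (induction k)
    case 0
    show ?case by (fact P0)
  next
    case (Suc k)
    note Pm = predict[of "Suc k", simplified, OF Suc]
    have "L (Suc k) = Pm (Suc k) * transpose_mat H *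
        mat_inv (H * Pm (Suc k) * transpose_mat H + r \<cdot>\<^sub>m 1\<^sub>m m)"
      and "P (Suc k) = (1\<^sub>m n - L (Suc k) * H) * Pm (Suc k)"
      using filter F by (auto simp: kalman_filter_def)
    then show ?case
      using sym_psd_kalman_update[OF Pm sym_psd_scaled_one[of r m] H] kalman_gain_equation[OF Pm H r] r
      by simp
  qed
  then show "sym_psd n (P k)" "1 \<le> k \<Longrightarrow> sym_psd n (Pm k)"
    using predict by auto
qed

text \<open>Clocks play no part here: the setting is any system whose lower state block drives
  neither the upper block nor the output, with output noise \<open>r I\<close> and semidefinite
  \<open>Q\<close> and \<open>P 0\<close>.\<close>

lemma kalman_filter_observable_blocks:
  assumes filter: "kalman_filter F G H W (r \<cdot>\<^sub>m 1\<^sub>m l) u y em e Pm P L"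
    and F: "F = four_block_mat Aoo (0\<^sub>m n m) Abo Abb"
    and H: "H = Co @\<^sub>c 0\<^sub>m l m"
    and W: "W = (To @\<^sub>r Tb) * Q * transpose_mat (To @\<^sub>r Tb)"
    and A: "Aoo \<in> carrier_mat n n" "Abo \<in> carrier_mat m n" "Abb \<in> carrier_mat m m"
    and C: "Co \<in> carrier_mat l n"
    and T: "To \<in> carrier_mat n d" "Tb \<in> carrier_mat m d"
    and Q: "sym_psd d Q" and r: "0 < r" and P0: "sym_psd (n + m) (P 0)"
    and blocks_P: "\<And>k. split_block (P k) n n = (P_oo k, P_ob k, P_bo k, P_bb k)"
    and blocks_Pm: "\<And>k. 1 \<le> k \<Longrightarrow> split_block (Pm k) n n = (Pm_oo k, Pm_ob k, Pm_bo k, Pm_bb k)"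
    and blocks_L: "\<And>k. 1 \<le> k \<Longrightarrow> L k = L_o k @\<^sub>r L_b k"
      "\<And>k. 1 \<le> k \<Longrightarrow> L_o k \<in> carrier_mat n l" "\<And>k. 1 \<le> k \<Longrightarrow> L_b k \<in> carrier_mat m l"
  shows "P_ob k = transpose_mat (P_bo k)"
    and "1 \<le> k \<Longrightarrow> Pm_ob k = transpose_mat (Pm_bo k)"
    and "1 \<le> k \<Longrightarrow> Pm_oo k @\<^sub>r Pm_bo k =
      F * (P_oo (k - 1) @\<^sub>r P_bo (k - 1)) * transpose_mat Aoo
      + (To * Q * transpose_mat To @\<^sub>r Tb * Q * transpose_mat To)"
    and "1 \<le> k \<Longrightarrow> L_o k @\<^sub>r L_b k = (Pm_oo k @\<^sub>r Pm_bo k) * transpose_mat Co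
      * mat_inv (Co * Pm_oo k * transpose_mat Co + r \<cdot>\<^sub>m 1\<^sub>m l)"
    and "1 \<le> k \<Longrightarrow> P_oo k @\<^sub>r P_bo k = (1\<^sub>m n - L_o k * Co) * Pm_oo k
      @\<^sub>r Pm_bo k * (1\<^sub>m n - transpose_mat Co * transpose_mat (L_o k))"
proof -
  define E :: "real mat" where "E = 1\<^sub>m n @\<^sub>r 0\<^sub>m m n"
  have E: "E \<in> carrier_mat (n + m) n"
    by (auto simp: E_def)
  have carF: "F \<in> carrier_mat (n + m) (n + m)" and carH: "H \<in> carrier_mat l (n + m)"
    and carT: "To @\<^sub>r Tb \<in> carrier_mat (n + m) d"
    using A C T by (auto simp: F H append_cols_carrier)
  have carQ: "Q \<in> carrier_mat d d"
    using Q by (rule sym_psdD)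
  have psdW: "sym_psd (n + m) W"
    unfolding W by (rule sym_psd_congruence[OF Q carT])
  have carW: "W \<in> carrier_mat (n + m) (n + m)"
    using psdW by (rule sym_psdD)
  note psd = kalman_covariances_psd[OF filter carF carH psdW r P0]
  \<comment> \<open>The zero block of \<open>F\<close> stands at the upper right, so the first block
    column of its transpose is \<open>Aoo^T\<close> above 0.\<close>
  have FE: "transpose_mat F * E = E * transpose_mat Aoo"
  proof -
    have "F = (Aoo @\<^sub>c 0\<^sub>m n m) @\<^sub>r (Abo @\<^sub>c Abb)"
      unfolding F using A by (intro eq_matI) (auto simp: append_rows_def append_cols_def)
    then show ?thesis
      using A carrier_matD[OF append_cols_carrier[OF A(2,3)]]
      by (simp add: E_def transpose_append_rows[of _ n "n + m" _ m] append_cols_carrier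
          append_cols_mult_append_rows[of _ "n + m" n _ m _ n] transpose_append_cols[of _ n n _ m]
          append_rows_mult[of _ n n _ m _ n])
  qed
  \<comment> \<open>\<open>E\<close> travels left through \<open>F^T\<close> until it meets
    \<open>X\<close>, so the second block column of \<open>X\<close> never enters the
    result.\<close>
  have FXFE: "F * X * transpose_mat F * E = F * (X * E) * transpose_mat Aoo"
    if X: "X \<in> carrier_mat (n + m) (n + m)" for X
  proof -
    have "F * X * transpose_mat F * E = F * X * (transpose_mat F * E)"
      using carF X E by (intro assoc_mult_mat[of _ "n + m" "n + m" _ "n + m"]) auto
    also have "\<dots> = F * (X * E) * transpose_mat Aoo"
      using carF X E A(1) unfolding FE
      by (simp add: assoc_mult_mat[of F "n + m" "n + m" X "n + m" _ n]
          assoc_mult_mat[of F "n + m" "n + m" "X * E" n _ n])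
    finally show ?thesis .
  qed
  have TE: "transpose_mat (To @\<^sub>r Tb) * E = transpose_mat To"
    using T by (simp add: E_def transpose_append_rows[of _ n d _ m]
        append_cols_mult_append_rows[of _ d n _ m _ n])
  have HE: "transpose_mat H = E * transpose_mat Co"
    using C by (simp add: H E_def transpose_append_cols[of _ l n _ m] append_rows_mult[of _ n n _ m _ l])
  have H_mult: "H * (X @\<^sub>r Y) = Co * X"
    if "X \<in> carrier_mat n j" "Y \<in> carrier_mat m j" for X Y and j :: nat
    using that C by (simp add: H append_cols_mult_append_rows[of _ l n _ m _ j])
  have carP: "P k \<in> carrier_mat (n + m) (n + m)" for k
    using psd(1) by (rule sym_psdD)
  have PE: "P k * E = P_oo k @\<^sub>r P_bo k" for k
    unfolding E_def by (rule split_block_first_columns[OF carP blocks_P])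
  show "P_ob k = transpose_mat (P_bo k)"
    by (rule split_block_symmetric[OF carP sym_psdD(2)[OF psd(1)] blocks_P])
  assume k: "1 \<le> k"
  have Pm_k: "Pm k = F * P (k - 1) * transpose_mat F + W"
    and L_k: "L k = Pm k * transpose_mat H * mat_inv (H * Pm k * transpose_mat H + r \<cdot>\<^sub>m 1\<^sub>m l)"
    and P_k: "P k = (1\<^sub>m (n + m) - L k * H) * Pm k"
    using filter k carF by (auto simp: kalman_filter_def)
  have psdPm: "sym_psd (n + m) (Pm k)"
    by (rule psd(2)[OF k])
  have carPm: "Pm k \<in> carrier_mat (n + m) (n + m)"
    using psdPm by (rule sym_psdD)
  have PmE: "Pm k * E = Pm_oo k @\<^sub>r Pm_bo k"
    unfolding E_def by (rule split_block_first_columns[OF carPm blocks_Pm[OF k]])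
  have blkPm: "Pm_oo k \<in> carrier_mat n n" "Pm_bo k \<in> carrier_mat m n"
    using split_block[OF blocks_Pm[OF k], of m m] carPm by auto
  note symPm = split_block_symmetric[OF carPm sym_psdD(2)[OF psdPm] blocks_Pm[OF k]]
  show "Pm_ob k = transpose_mat (Pm_bo k)"
    by (rule symPm(1))
  note blkL = blocks_L[OF k]
  have carL: "L k \<in> carrier_mat (n + m) l"
    using blkL by auto
  have "Pm_oo k @\<^sub>r Pm_bo k = F * P (k - 1) * transpose_mat F * E + W * E"
    using carF carP[of "k - 1"] carW E unfolding PmE[symmetric] Pm_k
    by (subst add_mult_distrib_mat[of _ "n + m" "n + m" _ E n]) auto
  also have "F * P (k - 1) * transpose_mat F * E = F * (P (k - 1) * E) * transpose_mat Aoo"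
    by (rule FXFE[OF carP])
  also have "\<dots> = F * (P_oo (k - 1) @\<^sub>r P_bo (k - 1)) * transpose_mat Aoo"
    unfolding PE ..
  also have "W * E = (To @\<^sub>r Tb) * Q * (transpose_mat (To @\<^sub>r Tb) * E)"
    using carT carQ E unfolding W by (intro assoc_mult_mat[of _ "n + m" d _ "n + m"]) auto
  also have "\<dots> = To * Q * transpose_mat To @\<^sub>r Tb * Q * transpose_mat To"
    using T carQ unfolding TE
    by (simp add: append_rows_mult[of _ n d _ m] del: assoc_mult_mat)
  finally show "Pm_oo k @\<^sub>r Pm_bo k =
      F * (P_oo (k - 1) @\<^sub>r P_bo (k - 1)) * transpose_mat Aoo
      + (To * Q * transpose_mat To @\<^sub>r Tb * Q * transpose_mat To)" .
  have PmH: "Pm k * transpose_mat H = (Pm_oo k @\<^sub>r Pm_bo k) * transpose_mat Co"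
    using carPm E C unfolding HE PmE[symmetric] by simp
  \<comment> \<open>On the left, \<open>H\<close> discards \<open>Pm_bo k\<close> as well, so the
    innovation covariance depends on \<open>Pm_oo k\<close> alone.\<close>
  have "H * Pm k * transpose_mat H = H * ((Pm_oo k @\<^sub>r Pm_bo k) * transpose_mat Co)"
    using carPm carH unfolding PmH[symmetric] by simp
  also have "\<dots> = Co * Pm_oo k * transpose_mat Co"
    using blkPm C by (simp add: append_rows_mult[of _ n n _ m _ l] H_mult[of _ l])
  finally have HPmH: "H * Pm k * transpose_mat H = Co * Pm_oo k * transpose_mat Co" .
  show "L_o k @\<^sub>r L_b k = (Pm_oo k @\<^sub>r Pm_bo k) * transpose_mat Co
      * mat_inv (Co * Pm_oo k * transpose_mat Co + r \<cdot>\<^sub>m 1\<^sub>m l)"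
    using L_k unfolding PmH HPmH blkL(1) .
  define S where "S = Co * Pm_oo k * transpose_mat Co + r \<cdot>\<^sub>m 1\<^sub>m l"
  have S: "S \<in> carrier_mat l l"
    using blkPm C by (auto simp: S_def)
  have symS: "transpose_mat S = S"
    unfolding S_def HPmH[symmetric]
    by (intro sym_psdD(2)[of l] sym_psd_add sym_psd_congruence[OF psdPm carH]
        sym_psd_scaled_one less_imp_le[OF r])
  have "L k * S = Pm k * transpose_mat H"
    unfolding S_def HPmH[symmetric] by (subst L_k) (rule kalman_gain_equation(2)[OF psdPm carH r])
  then have "L_o k * S @\<^sub>r L_b k * S = Pm_oo k * transpose_mat Co @\<^sub>r Pm_bo k * transpose_mat Co"
    using blkL blkPm C S
    by (simp add: PmH append_rows_mult[of _ n l _ m _ l] append_rows_mult[of _ n n _ m _ l])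
  then have gain_o: "L_o k * S = Pm_oo k * transpose_mat Co"
    and gain_b: "L_b k * S = Pm_bo k * transpose_mat Co"
    using blkL blkPm C S append_rows_inject[of "L_o k * S" n l "L_b k * S" m
        "Pm_oo k * transpose_mat Co" "Pm_bo k * transpose_mat Co"] by auto
  \<comment> \<open>Symmetry of \<open>S\<close> and of \<open>Pm_oo k\<close> turns the upper gain
    equation into one with \<open>L_o^T\<close> as a right factor.\<close>
  have "transpose_mat (L_o k * S) = transpose_mat (Pm_oo k * transpose_mat Co)"
    by (simp only: gain_o)
  then have gain_t: "S * transpose_mat (L_o k) = Co * Pm_oo k"
    using blkL blkPm C S symS symPm(2) by (simp add: transpose_mult[of _ n l _ l] transpose_mult[of _ n n _ l])
  \<comment> \<open>Both corrections equal \<open>L_b S L_o^T\<close>: on one side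
    \<open>S L_o^T\<close> is replaced by the transposed upper gain equation, on the other
    \<open>L_b S\<close> by the lower one.\<close>
  have bottom: "L_b k * (Co * Pm_oo k) = Pm_bo k * (transpose_mat Co * transpose_mat (L_o k))"
  proof -
    have "L_b k * (Co * Pm_oo k) = L_b k * S * transpose_mat (L_o k)"
      using blkL S by (simp add: gain_t[symmetric])
    also have "\<dots> = Pm_bo k * (transpose_mat Co * transpose_mat (L_o k))"
      using blkL blkPm C by (simp add: gain_b)
    finally show ?thesis .
  qed
  \<comment> \<open>\<open>L k * H\<close> now acts on a stacked block column, of which
    \<open>H\<close> sees only the upper part.\<close>
  have "P_oo k @\<^sub>r P_bo k = (1\<^sub>m (n + m) - L k * H) * (Pm k * E)"
    using carL carH carPm E unfolding PE[symmetric] P_k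
    by (subst assoc_mult_mat[of _ "n + m" "n + m"]) auto
  also have "\<dots> = (Pm_oo k @\<^sub>r Pm_bo k) - L k * (H * (Pm_oo k @\<^sub>r Pm_bo k))"
    using carL carH blkPm
    by (simp add: PmE minus_mult_distrib_mat[of _ "n + m" "n + m" _ _ n]
        left_mult_one_mat[OF carrier_append_rows]
        assoc_mult_mat[of _ "n + m" l _ "n + m" "Pm_oo k @\<^sub>r Pm_bo k" n])
  also have "L k * (H * (Pm_oo k @\<^sub>r Pm_bo k)) = L_o k * (Co * Pm_oo k) @\<^sub>r L_b k * (Co * Pm_oo k)"
    using blkL blkPm C by (simp add: H_mult[of _ n] append_rows_mult[of _ n l _ m _ n])
  also have "(Pm_oo k @\<^sub>r Pm_bo k) - \<dots> =
      (Pm_oo k - L_o k * (Co * Pm_oo k)) @\<^sub>r (Pm_bo k - L_b k * (Co * Pm_oo k))"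
    using blkL blkPm C by (intro append_rows_minus[of _ n n _ m]) auto
  also have "Pm_oo k - L_o k * (Co * Pm_oo k) = (1\<^sub>m n - L_o k * Co) * Pm_oo k"
    using blkL blkPm C by (simp add: minus_mult_distrib_mat[of _ n n _ _ n])
  also have "Pm_bo k - L_b k * (Co * Pm_oo k) =
      Pm_bo k * (1\<^sub>m n - transpose_mat Co * transpose_mat (L_o k))"
    using blkL blkPm C by (simp add: bottom mult_minus_distrib_mat[of _ m n _ n])
  finally show "P_oo k @\<^sub>r P_bo k = (1\<^sub>m n - L_o k * Co) * Pm_oo k
      @\<^sub>r Pm_bo k * (1\<^sub>m n - transpose_mat Co * transpose_mat (L_o k))" .
qed

subsection \<open>Noise of the clock ensemble\<close>

text \<open>The forms in this section are bilinear rather than quadratic because the off-diagonal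
  blocks of the covariance pair different parts of the vector.\<close>

lemma four_block_bilinear:
  fixes A :: "'a::comm_ring_1 mat"
  assumes "A \<in> carrier_mat n n'" "B \<in> carrier_mat n m'" "C \<in> carrier_mat m n'" "D \<in> carrier_mat m m'"
    and "a \<in> carrier_vec n" "b \<in> carrier_vec m" "a' \<in> carrier_vec n'" "b' \<in> carrier_vec m'"
  shows "(a @\<^sub>v b) \<bullet> (four_block_mat A B C D *\<^sub>v (a' @\<^sub>v b')) =
    a \<bullet> (A *\<^sub>v a') + a \<bullet> (B *\<^sub>v b') + b \<bullet> (C *\<^sub>v a') + b \<bullet> (D *\<^sub>v b')"
  using assms
  by (simp add: four_block_mat_mult_vec scalar_prod_append[of _ n _ m] scalar_prod_add_distrib[of _ n]
      scalar_prod_add_distrib[of _ m])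

lemma mat_diag_bilinear:
  fixes d :: "nat \<Rightarrow> 'a::comm_ring_1"
  assumes "a \<in> carrier_vec n" "b \<in> carrier_vec n"
  shows "a \<bullet> (mat_diag n d *\<^sub>v b) = (\<Sum>i<n. d i * (a $ i * b $ i))"
proof -
  have "mat_diag n d *\<^sub>v b = Matrix.vec n (\<lambda>i. d i * b $ i)"
    using assms by (intro eq_vecI) (auto simp: mat_diag_def scalar_prod_def if_distrib if_distribR cong: if_cong)
  then show ?thesis
    using assms by (simp add: scalar_prod_def atLeast0LessThan mult.left_commute)
qed

lemma transpose_mat_diag: "transpose_mat (mat_diag n d) = mat_diag n d"
  by (intro eq_matI) (auto simp: mat_diag_def)

lemma smult_mult_mat_vec:
  fixes A :: "'a::comm_ring_1 mat"
  assumes "A \<in> carrier_mat n m" "v \<in> carrier_vec m"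
  shows "(c \<cdot>\<^sub>m A) *\<^sub>v v = c \<cdot>\<^sub>v (A *\<^sub>v v)"
  using assms by (intro eq_vecI) (auto simp: scalar_prod_def sum_distrib_left mult.assoc)

lemma zero_mat_mult_vec:
  fixes v :: "'a::semiring_0 vec"
  assumes "v \<in> carrier_vec m"
  shows "0\<^sub>m n m *\<^sub>v v = 0\<^sub>v n"
  using assms by (intro eq_vecI) auto

text \<open>The form is the integral over \<open>0 \<le> t \<le> \<tau>\<close> of \<open>(a t\<^sup>2 / 2 + b t + c)\<^sup>2\<close>; the squares come
  from expanding the integrand in Legendre polynomials.\<close>

lemma drift_noise_form_nonneg:
  fixes a b c \<tau> :: real
  assumes "0 < \<tau>"
  shows "0 \<le> \<tau> ^ 5 / 20 * a\<^sup>2 + \<tau> ^ 4 / 4 * (a * b) + \<tau> ^ 3 / 3 * b\<^sup>2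
    + \<tau> ^ 3 / 3 * (a * c) + \<tau>\<^sup>2 * (b * c) + \<tau> * c\<^sup>2"
proof -
  have "\<tau> ^ 5 / 20 * a\<^sup>2 + \<tau> ^ 4 / 4 * (a * b) + \<tau> ^ 3 / 3 * b\<^sup>2
      + \<tau> ^ 3 / 3 * (a * c) + \<tau>\<^sup>2 * (b * c) + \<tau> * c\<^sup>2
    = \<tau> * (\<tau>\<^sup>2 / 6 * a + \<tau> / 2 * b + c)\<^sup>2 + \<tau> ^ 3 / 12 * (\<tau> / 2 * a + b)\<^sup>2 + \<tau> ^ 5 / 720 * a\<^sup>2"
    by (simp add: power2_eq_square power3_eq_cube power4_eq_xxxx eval_nat_numeral field_simps)
  then show ?thesis
    using assms by simp
qed

text \<open>This is the integral of \<open>(a t + b)^2\<close> over 0 \<le> t \<le> \<tau>. The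
  first square comes from the mean value of \<open>a t + b\<close>, the second from the deviation
  from it.\<close>

lemma frequency_noise_form_nonneg:
  fixes a b \<tau> :: real
  assumes "0 < \<tau>"
  shows "0 \<le> \<tau> ^ 3 / 3 * a\<^sup>2 + \<tau>\<^sup>2 * (a * b) + \<tau> * b\<^sup>2"
proof -
  have "\<tau> ^ 3 / 3 * a\<^sup>2 + \<tau>\<^sup>2 * (a * b) + \<tau> * b\<^sup>2 = \<tau> * (\<tau> / 2 * a + b)\<^sup>2 + \<tau> ^ 3 / 12 * a\<^sup>2"
    by (simp add: power2_eq_square power3_eq_cube field_simps)
  then show ?thesis
    using assms by simp
qed

section \<open>Positive semidefiniteness of the process noise covariance\<close>

context
  fixes N M :: nat
  assumes MN: "M \<le> N"
begin

lemma Sigma_carriers: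
  "Sigma_diag N s \<in> carrier_mat N N" "Sigma5 N M s \<in> carrier_mat M M"
  "Sigma3 N M s \<in> carrier_mat N N" "Sigma4 N M s \<in> carrier_mat N M"
  using MN by (auto simp: Sigma_diag_def Sigma5_def Sigma3_def Sigma4_def append_rows_def mat_diag_def)

lemma Sigma_transpose:
  "transpose_mat (Sigma_diag N s) = Sigma_diag N s" "transpose_mat (Sigma3 N M s) = Sigma3 N M s"
  "transpose_mat (Sigma5 N M s) = Sigma5 N M s"
proof -
  show "transpose_mat (Sigma_diag N s) = Sigma_diag N s" "transpose_mat (Sigma5 N M s) = Sigma5 N M s"
    by (simp_all add: Sigma_diag_def Sigma5_def transpose_mat_diag)
  then show "transpose_mat (Sigma3 N M s) = Sigma3 N M s"
    using Sigma_carriers(2)[of s]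
    by (simp add: Sigma3_def transpose_four_block_mat[of _ "N - M" "N - M" _ M _ M])
qed

lemma Sigma_diag_bilinear:
  assumes "a \<in> carrier_vec N" "b \<in> carrier_vec N"
  shows "a \<bullet> (Sigma_diag N s *\<^sub>v b) = (\<Sum>i<N. (s (i + 1))\<^sup>2 * (a $ i * b $ i))"
  unfolding Sigma_diag_def using assms by (rule mat_diag_bilinear)

lemma Sigma5_bilinear:
  assumes "c \<in> carrier_vec M" "d \<in> carrier_vec M"
  shows "c \<bullet> (Sigma5 N M s *\<^sub>v d) = (\<Sum>i<M. (s (N - M + i + 1))\<^sup>2 * (c $ i * d $ i))"
  unfolding Sigma5_def using assms by (rule mat_diag_bilinear)

text \<open>The cut separates cesium from maser clocks. The last fact leads back to entries of the
  undivided vector, in which the sums below are written.\<close>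

lemma carrier_vec_splitE:
  assumes "a \<in> carrier_vec N"
  obtains a1 a2 where "a = a1 @\<^sub>v a2" "a1 \<in> carrier_vec (N - M)" "a2 \<in> carrier_vec M"
    "\<And>i. i < M \<Longrightarrow> a $ (N - M + i) = a2 $ i"
proof
  show "a = Matrix.vec (N - M) (($) a) @\<^sub>v Matrix.vec M (\<lambda>i. a $ (N - M + i))"
    using assms MN by (intro eq_vecI) auto
qed auto

text \<open>Indexed this way, the forms of \<open>Sigma3\<close>, \<open>Sigma4\<close> and
  \<open>Sigma5\<close> are sums over the same maser index with the same weights, so they can be
  merged into one form per maser. The final \<open>+ 1\<close> converts to clock numbers, which
  start at 1.\<close>

lemma Sigma3_bilinear:
  assumes "a \<in> carrier_vec N" "b \<in> carrier_vec N"
  shows "a \<bullet> (Sigma3 N M s *\<^sub>v b) =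
    (\<Sum>i<M. (s (N - M + i + 1))\<^sup>2 * (a $ (N - M + i) * b $ (N - M + i)))"
proof -
  obtain a1 a2 where a: "a = a1 @\<^sub>v a2" "a1 \<in> carrier_vec (N - M)" "a2 \<in> carrier_vec M"
    "\<And>i. i < M \<Longrightarrow> a $ (N - M + i) = a2 $ i"
    using carrier_vec_splitE[OF assms(1)] by blast
  obtain b1 b2 where b: "b = b1 @\<^sub>v b2" "b1 \<in> carrier_vec (N - M)" "b2 \<in> carrier_vec M"
    "\<And>i. i < M \<Longrightarrow> b $ (N - M + i) = b2 $ i"
    using carrier_vec_splitE[OF assms(2)] by blast
  have "a \<bullet> (Sigma3 N M s *\<^sub>v b) = a2 \<bullet> (Sigma5 N M s *\<^sub>v b2)"
    unfolding Sigma3_def a(1) b(1) using a(2,3) b(2,3) Sigma_carriers(2)[of s]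
    by (simp add: four_block_bilinear[of _ "N - M" "N - M" _ M _ M] zero_mat_mult_vec)
  also have "\<dots> = (\<Sum>i<M. (s (N - M + i + 1))\<^sup>2 * (a2 $ i * b2 $ i))"
    using a(3) b(3) by (rule Sigma5_bilinear)
  finally show ?thesis
    by (simp add: a(4) b(4))
qed

lemma Sigma4_bilinear:
  assumes "a \<in> carrier_vec N" "c \<in> carrier_vec M"
  shows "a \<bullet> (Sigma4 N M s *\<^sub>v c) = (\<Sum>i<M. (s (N - M + i + 1))\<^sup>2 * (a $ (N - M + i) * c $ i))"
proof -
  obtain a1 a2 where a: "a = a1 @\<^sub>v a2" "a1 \<in> carrier_vec (N - M)" "a2 \<in> carrier_vec M"
    "\<And>i. i < M \<Longrightarrow> a $ (N - M + i) = a2 $ i"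
    using carrier_vec_splitE[OF assms(1)] by blast
  have "a \<bullet> (Sigma4 N M s *\<^sub>v c) = a2 \<bullet> (Sigma5 N M s *\<^sub>v c)"
    unfolding Sigma4_def a(1) using a(2,3) assms(2) Sigma_carriers(2)[of s]
    by (simp add: mat_mult_append[of _ "N - M" M _ M] zero_mat_mult_vec
        scalar_prod_append[of _ "N - M" _ M])
  also have "\<dots> = (\<Sum>i<M. (s (N - M + i + 1))\<^sup>2 * (a2 $ i * c $ i))"
    using a(3) assms(2) by (rule Sigma5_bilinear)
  finally show ?thesis
    by (simp add: a(4))
qed

lemma Sigma4_transpose_bilinear:
  assumes "a \<in> carrier_vec N" "c \<in> carrier_vec M"
  shows "c \<bullet> (transpose_mat (Sigma4 N M s) *\<^sub>v a) =
    (\<Sum>i<M. (s (N - M + i + 1))\<^sup>2 * (a $ (N - M + i) * c $ i))"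
  using assms Sigma_carriers(4)[of s]
  by (simp add: comm_scalar_prod[of c M] transpose_vec_mult_scalar[of _ N M] Sigma4_bilinear)

text \<open>Sorted by variances, the quadratic form falls apart into forms of single clocks: a
  square for \<open>s1\<close>, a form in phase and frequency for \<open>s2\<close>, and a form in
  phase, frequency and drift for \<open>s3\<close>.\<close>

lemma sym_psd_ens_Q:
  assumes \<tau>: "0 < \<tau>"
  shows "sym_psd (2 * N + M) (ens_Q N M \<tau> s1 s2 s3)"
proof -
  let ?S1 = "Sigma_diag N s1" and ?S2 = "Sigma_diag N s2" and ?S3 = "Sigma3 N M s3"
    and ?S4 = "Sigma4 N M s3" and ?S5 = "Sigma5 N M s3"
  define Q11 where "Q11 = \<tau> \<cdot>\<^sub>m ?S1 + (\<tau> ^ 3 / 3) \<cdot>\<^sub>m ?S2 + (\<tau> ^ 5 / 20) \<cdot>\<^sub>m ?S3"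
  define Q12 where "Q12 = (\<tau>\<^sup>2 / 2) \<cdot>\<^sub>m ?S2 + (\<tau> ^ 4 / 8) \<cdot>\<^sub>m ?S3"
  define Q22 where "Q22 = \<tau> \<cdot>\<^sub>m ?S2 + (\<tau> ^ 3 / 3) \<cdot>\<^sub>m ?S3"
  define Q13 where "Q13 = (\<tau> ^ 3 / 6) \<cdot>\<^sub>m ?S4"
  define Q23 where "Q23 = (\<tau>\<^sup>2 / 2) \<cdot>\<^sub>m ?S4"
  define Q33 where "Q33 = \<tau> \<cdot>\<^sub>m ?S5"
  note defs = Q11_def Q12_def Q22_def Q13_def Q23_def Q33_def
  note S = Sigma_carriers
  have c: "Q11 \<in> carrier_mat N N" "Q12 \<in> carrier_mat N N" "Q22 \<in> carrier_mat N N"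
    "Q13 \<in> carrier_mat N M" "Q23 \<in> carrier_mat N M" "Q33 \<in> carrier_mat M M"
    using S by (auto simp: defs)
  define Qx where "Qx = four_block_mat Q11 Q12 Q12 Q22"
  have smult_T: "transpose_mat (x \<cdot>\<^sub>m X) = x \<cdot>\<^sub>m transpose_mat X" for x :: real and X
    by (intro eq_matI) auto
  have Q: "ens_Q N M \<tau> s1 s2 s3 =
      four_block_mat Qx (Q13 @\<^sub>r Q23) (transpose_mat Q13 @\<^sub>c transpose_mat Q23) Q33"
    by (simp add: ens_Q_def Let_def defs Qx_def smult_T)
  have Qx: "Qx \<in> carrier_mat (2 * N) (2 * N)"
    using c by (auto simp: Qx_def)
  have off: "Q13 @\<^sub>r Q23 \<in> carrier_mat (2 * N) M"
    "transpose_mat Q13 @\<^sub>c transpose_mat Q23 \<in> carrier_mat M (2 * N)"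
    using c append_cols_carrier[of "transpose_mat Q13" M N "transpose_mat Q23" N] carrier_append_rows[of Q13 N M Q23 N]
    by (auto simp: mult_2)
  have sym: "transpose_mat Q11 = Q11" "transpose_mat Q12 = Q12" "transpose_mat Q22 = Q22"
    "transpose_mat Q33 = Q33"
    using S by (simp_all add: defs transpose_add[of _ N N] smult_T Sigma_transpose)
  have "transpose_mat (ens_Q N M \<tau> s1 s2 s3) = ens_Q N M \<tau> s1 s2 s3"
    unfolding Q using c Qx off
    by (simp add: transpose_four_block_mat[of _ "2 * N" "2 * N" _ M _ M] sym
        transpose_append_rows[of _ N M _ N] transpose_append_cols[of _ M N _ N])
      (simp add: Qx_def transpose_four_block_mat[of _ N N _ N _ N] sym)
  moreover have "0 \<le> v \<bullet> (ens_Q N M \<tau> s1 s2 s3 *\<^sub>v v)" if v: "v \<in> carrier_vec (2 * N + M)" for v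
  proof -
    \<comment> \<open>\<open>a\<close>, \<open>b\<close> and \<open>d\<close> are the phase,
      frequency and drift parts of \<open>v\<close>.\<close>
    define a where "a = Matrix.vec N (\<lambda>i. v $ i)"
    define b where "b = Matrix.vec N (\<lambda>i. v $ (N + i))"
    define d where "d = Matrix.vec M (\<lambda>i. v $ (2 * N + i))"
    have abd: "a \<in> carrier_vec N" "b \<in> carrier_vec N" "d \<in> carrier_vec M"
      by (auto simp: a_def b_def d_def)
    have ab: "a @\<^sub>v b \<in> carrier_vec (2 * N)"
      using abd by (simp add: mult_2)
    have v_eq: "v = (a @\<^sub>v b) @\<^sub>v d"
      using v by (intro eq_vecI) (auto simp: a_def b_def d_def mult_2)
    have up: "(a @\<^sub>v b) \<bullet> ((Q13 @\<^sub>r Q23) *\<^sub>v d) = a \<bullet> (Q13 *\<^sub>v d) + b \<bullet> (Q23 *\<^sub>v d)"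
      using c abd by (simp add: mat_mult_append[of _ N M _ N] scalar_prod_append[of _ N _ N])
    have low: "d \<bullet> ((transpose_mat Q13 @\<^sub>c transpose_mat Q23) *\<^sub>v (a @\<^sub>v b)) =
        d \<bullet> (transpose_mat Q13 *\<^sub>v a) + d \<bullet> (transpose_mat Q23 *\<^sub>v b)"
      using c abd by (simp add: append_cols_mult_append_vec[of _ M N _ N] scalar_prod_add_distrib[of _ M])
    note expand = add_mult_distrib_mat_vec[of _ N N] smult_mult_mat_vec[of _ N N]
      smult_mult_mat_vec[of _ N M] smult_mult_mat_vec[of _ M M] smult_mult_mat_vec[of _ M N]
      scalar_prod_add_distrib[of _ N]
    \<comment> \<open>Phases and frequencies of the masers only, aligned with the index of
      \<open>d\<close>.\<close>
    define x where "x i = a $ (N - M + i)" for i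
    define y where "y i = b $ (N - M + i)" for i
    have "v \<bullet> (ens_Q N M \<tau> s1 s2 s3 *\<^sub>v v) =
        a \<bullet> (Q11 *\<^sub>v a) + a \<bullet> (Q12 *\<^sub>v b) + b \<bullet> (Q12 *\<^sub>v a) + b \<bullet> (Q22 *\<^sub>v b)
        + (a \<bullet> (Q13 *\<^sub>v d) + b \<bullet> (Q23 *\<^sub>v d))
        + (d \<bullet> (transpose_mat Q13 *\<^sub>v a) + d \<bullet> (transpose_mat Q23 *\<^sub>v b)) + d \<bullet> (Q33 *\<^sub>v d)"
      unfolding Q v_eq four_block_bilinear[OF Qx off c(6) ab abd(3) ab abd(3)] up low
      unfolding Qx_def four_block_bilinear[OF c(1,2,2,3) abd(1,2,1,2)] ..
    \<comment> \<open>Every off-diagonal block contributes twice, which doubles the coefficients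
      1/2, 1/8 and 1/6 of the mixed terms to 1, 1/4 and 1/3.\<close>
    also have "\<dots> = (\<Sum>i<N. (s1 (i + 1))\<^sup>2 * (\<tau> * (a $ i)\<^sup>2))
        + (\<Sum>i<N. (s2 (i + 1))\<^sup>2 *
             (\<tau> ^ 3 / 3 * (a $ i)\<^sup>2 + \<tau>\<^sup>2 * (a $ i * b $ i) + \<tau> * (b $ i)\<^sup>2))
        + (\<Sum>i<M. (s3 (N - M + i + 1))\<^sup>2 *
             (\<tau> ^ 5 / 20 * (x i)\<^sup>2 + \<tau> ^ 4 / 4 * (x i * y i) + \<tau> ^ 3 / 3 * (y i)\<^sup>2
              + \<tau> ^ 3 / 3 * (x i * d $ i) + \<tau>\<^sup>2 * (y i * d $ i) + \<tau> * (d $ i)\<^sup>2))"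
    proof -
      \<comment> \<open>With the weighted sums hidden behind linear functionals, what remains is a
        comparison of coefficients that does not look inside the sums.\<close>
      define m1 m2 m3 where "m1 h = (\<Sum>i<N. (s1 (i + 1))\<^sup>2 * h i)"
        and "m2 h = (\<Sum>i<N. (s2 (i + 1))\<^sup>2 * h i)"
        and "m3 h = (\<Sum>i<M. (s3 (N - M + i + 1))\<^sup>2 * h i)" for h :: "nat \<Rightarrow> real"
      have linear: "m1 (\<lambda>i. k * h i) = k * m1 h"
        "m2 (\<lambda>i. k * h i) = k * m2 h" "m2 (\<lambda>i. g i + h i) = m2 g + m2 h"
        "m3 (\<lambda>i. k * h i) = k * m3 h" "m3 (\<lambda>i. g i + h i) = m3 g + m3 h" for g h k
        by (simp_all add: m1_def m2_def m3_def sum_distrib_left sum.distrib distrib_left mult.left_commute)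
      have forms: "a \<bullet> (?S1 *\<^sub>v a) = m1 (\<lambda>i. (a $ i)\<^sup>2)"
        "a \<bullet> (?S2 *\<^sub>v a) = m2 (\<lambda>i. (a $ i)\<^sup>2)" "b \<bullet> (?S2 *\<^sub>v b) = m2 (\<lambda>i. (b $ i)\<^sup>2)"
        "a \<bullet> (?S2 *\<^sub>v b) = m2 (\<lambda>i. a $ i * b $ i)" "b \<bullet> (?S2 *\<^sub>v a) = m2 (\<lambda>i. a $ i * b $ i)"
        "a \<bullet> (?S3 *\<^sub>v a) = m3 (\<lambda>i. (x i)\<^sup>2)" "b \<bullet> (?S3 *\<^sub>v b) = m3 (\<lambda>i. (y i)\<^sup>2)"
        "a \<bullet> (?S3 *\<^sub>v b) = m3 (\<lambda>i. x i * y i)" "b \<bullet> (?S3 *\<^sub>v a) = m3 (\<lambda>i. x i * y i)"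
        "a \<bullet> (?S4 *\<^sub>v d) = m3 (\<lambda>i. x i * d $ i)" "b \<bullet> (?S4 *\<^sub>v d) = m3 (\<lambda>i. y i * d $ i)"
        "d \<bullet> (transpose_mat ?S4 *\<^sub>v a) = m3 (\<lambda>i. x i * d $ i)"
        "d \<bullet> (transpose_mat ?S4 *\<^sub>v b) = m3 (\<lambda>i. y i * d $ i)"
        "d \<bullet> (?S5 *\<^sub>v d) = m3 (\<lambda>i. (d $ i)\<^sup>2)"
        using abd
        by (simp_all add: m1_def m2_def m3_def x_def y_def power2_eq_square Sigma_diag_bilinear
            Sigma3_bilinear Sigma4_bilinear Sigma4_transpose_bilinear Sigma5_bilinear
            mult.commute[of "b $ _" "a $ _"])
      have Sx: "?S1 *\<^sub>v a \<in> carrier_vec N" "?S2 *\<^sub>v a \<in> carrier_vec N" "?S2 *\<^sub>v b \<in> carrier_vec N"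
        "?S3 *\<^sub>v a \<in> carrier_vec N" "?S3 *\<^sub>v b \<in> carrier_vec N"
        "?S4 *\<^sub>v d \<in> carrier_vec N" "?S5 *\<^sub>v d \<in> carrier_vec M"
        "transpose_mat ?S4 *\<^sub>v a \<in> carrier_vec M" "transpose_mat ?S4 *\<^sub>v b \<in> carrier_vec M"
        by (rule mult_mat_vec_carrier[OF _ abd(1)] mult_mat_vec_carrier[OF _ abd(2)]
            mult_mat_vec_carrier[OF _ abd(3)], simp add: S)+
      show ?thesis
        unfolding m1_def[symmetric] m2_def[symmetric] m3_def[symmetric] linear
        using S abd Sx
        by (simp add: defs smult_T expand forms scalar_prod_smult_distrib[of _ N]
            scalar_prod_smult_distrib[of _ M] algebra_simps)
    qed
    also have "\<dots> \<ge> 0"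
      using \<tau> by (intro add_nonneg_nonneg sum_nonneg mult_nonneg_nonneg frequency_noise_form_nonneg
          drift_noise_form_nonneg) auto
    finally show ?thesis .
  qed
  ultimately show ?thesis
    using Qx c by (auto simp: sym_psd_def Q)
qed

end

section \<open>Dimensions of the model matrices\<close>

lemma kronecker_carrier:
  assumes "X \<in> carrier_mat a b" "Y \<in> carrier_mat c d"
  shows "X \<otimes>\<^sub>k Y \<in> carrier_mat (a * c) (b * d)"
  using assms by (auto simp: kronecker_def)

lemma clock_carriers:
  "clock_A \<tau> \<in> carrier_mat 2 2" "clock_beta \<tau> \<in> carrier_mat 2 1" "clock_B \<tau> \<in> carrier_mat 2 1"
  "clock_C \<in> carrier_mat 1 2"
  by (auto simp: clock_A_def clock_beta_def clock_B_def clock_C_def mat_of_rows_list_def)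

lemma clock_J_carrier: "M \<le> N \<Longrightarrow> clock_J N M \<in> carrier_mat N M"
  using carrier_append_rows[of "0\<^sub>m (N - M) M" "N - M" M "1\<^sub>m M" M] by (simp add: clock_J_def)

lemma ensemble_carriers:
  assumes "M \<le> N" "V \<in> carrier_mat (N - 1) N" "q \<in> carrier_vec N"
  shows "A_oo N M \<tau> V \<in> carrier_mat (2 * (N - 1) + M) (2 * (N - 1) + M)"
    "A_bo N M \<tau> q \<in> carrier_mat 2 (2 * (N - 1) + M)"
    "C_o N M \<in> carrier_mat (N - 1) (2 * (N - 1) + M)"
    "T_o N M V \<in> carrier_mat (2 * (N - 1) + M) (2 * N + M)"
    "T_b M q \<in> carrier_mat 2 (2 * N + M)"
proof -
  note J = clock_J_carrier[OF assms(1)]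
  show "A_oo N M \<tau> V \<in> carrier_mat (2 * (N - 1) + M) (2 * (N - 1) + M)"
    using kronecker_carrier[OF clock_carriers(1) one_carrier_mat]
    unfolding A_oo_def by (intro four_block_carrier_mat one_carrier_mat)
  show "A_bo N M \<tau> q \<in> carrier_mat 2 (2 * (N - 1) + M)"
    using kronecker_carrier[OF clock_carriers(2) mult_carrier_mat[OF mat_of_row_carrier(1)[OF assms(3)] J]]
    unfolding A_bo_def by (intro append_cols_carrier) auto
  show "C_o N M \<in> carrier_mat (N - 1) (2 * (N - 1) + M)"
    using kronecker_carrier[OF clock_carriers(4) one_carrier_mat[of "N - 1"]]
    unfolding C_o_def by (intro append_cols_carrier) auto
  show "T_o N M V \<in> carrier_mat (2 * (N - 1) + M) (2 * N + M)"
    using kronecker_carrier[OF one_carrier_mat assms(2)]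
    unfolding T_o_def by (intro four_block_carrier_mat one_carrier_mat)
  show "T_b M q \<in> carrier_mat 2 (2 * N + M)"
    using kronecker_carrier[OF one_carrier_mat[of 2] mat_of_row_carrier(1)[OF assms(3)]]
    unfolding T_b_def by (intro append_cols_carrier) auto
qed

text \<open>Estimates are random, gains and covariances are not: the vector recursions are read off
  the filter at each sample point, and the matrix recursions come from the block lemma.\<close>

theorem lemma1:
  fixes \<Omega> :: "'w measure" and N M :: nat and \<tau> r :: real
    and V :: "real mat" and q :: "real vec" and s1 s2 s3 :: "nat \<Rightarrow> real"
    and p f z vx vz u y w eta_o eta_b :: "nat \<Rightarrow> 'w \<Rightarrow> real vec"
    and em em_o em_b e e_o e_b :: "nat \<Rightarrow> 'w \<Rightarrow> real vec"
    and Pm Pm_oo Pm_ob Pm_bo Pm_bb P P_oo P_ob P_bo P_bb L L_o L_b :: "nat \<Rightarrow> real mat"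
  assumes "prob_space \<Omega>"
    and "0 < M" and "M < N" and "0 < \<tau>" and "0 < r"
    and "V \<in> carrier_mat (N - 1) N"
    and "mat_kernel V = range (\<lambda>c. c \<cdot>\<^sub>v ones N)"
    and "\<And>k \<omega>. \<omega> \<in> space \<Omega> \<Longrightarrow> p k \<omega> \<in> carrier_vec N \<and> f k \<omega> \<in> carrier_vec N \<and>
           z k \<omega> \<in> carrier_vec M \<and> u k \<omega> \<in> carrier_vec N \<and> y k \<omega> \<in> carrier_vec (N - 1)"
    and "\<And>k \<omega>. \<omega> \<in> space \<Omega> \<Longrightarrow> vx k \<omega> \<in> carrier_vec (2 * N) \<and> vz k \<omega> \<in> carrier_vec M"
    and "white_gaussian \<Omega> (2 * N + M) (ens_Q N M \<tau> s1 s2 s3) (\<lambda>k \<omega>. vx k \<omega> @\<^sub>v vz k \<omega>)"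
    and "white_gaussian \<Omega> (N - 1) (r \<cdot>\<^sub>m 1\<^sub>m (N - 1)) w"
    and "\<And>k \<omega>. \<omega> \<in> space \<Omega> \<Longrightarrow>
           (p (k + 1) \<omega> @\<^sub>v f (k + 1) \<omega>) @\<^sub>v z (k + 1) \<omega> =
             ens_A N M \<tau> *\<^sub>v ((p k \<omega> @\<^sub>v f k \<omega>) @\<^sub>v z k \<omega>) + ens_B N M \<tau> *\<^sub>v u k \<omega>
             + (vx k \<omega> @\<^sub>v vz k \<omega>)"
    and "\<And>k \<omega>. \<omega> \<in> space \<Omega> \<Longrightarrow>
           y k \<omega> = ens_C N M V *\<^sub>v ((p k \<omega> @\<^sub>v f k \<omega>) @\<^sub>v z k \<omega>) + w k \<omega>"
    and "q \<in> carrier_vec N" and "q \<bullet> ones N = 1"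
    and "\<And>k \<omega>. \<omega> \<in> space \<Omega> \<Longrightarrow>
           eta_o k \<omega> \<in> carrier_vec (2 * (N - 1) + M) \<and> eta_b k \<omega> \<in> carrier_vec 2 \<and>
           eta_o k \<omega> @\<^sub>v eta_b k \<omega> = T_full N M V q *\<^sub>v ((p k \<omega> @\<^sub>v f k \<omega>) @\<^sub>v z k \<omega>)"
    and "sym_psd (2 * N + M) (P 0)"
    and "\<And>\<omega>. \<omega> \<in> space \<Omega> \<Longrightarrow>
           kalman_filter (A_full N M \<tau> V q) (B_full N M \<tau> V q) (C_full N M)
             (T_full N M V q * ens_Q N M \<tau> s1 s2 s3 * transpose_mat (T_full N M V q))
             (r \<cdot>\<^sub>m 1\<^sub>m (N - 1))
             (\<lambda>k. u k \<omega>) (\<lambda>k. y k \<omega>) (\<lambda>k. em k \<omega>) (\<lambda>k. e k \<omega>) Pm P L"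
    and "\<And>k \<omega>. \<omega> \<in> space \<Omega> \<Longrightarrow> e k \<omega> = e_o k \<omega> @\<^sub>v e_b k \<omega> \<and>
           e_o k \<omega> \<in> carrier_vec (2 * (N - 1) + M) \<and> e_b k \<omega> \<in> carrier_vec 2"
    and "\<And>k \<omega>. k \<ge> 1 \<Longrightarrow> \<omega> \<in> space \<Omega> \<Longrightarrow> em k \<omega> = em_o k \<omega> @\<^sub>v em_b k \<omega> \<and>
           em_o k \<omega> \<in> carrier_vec (2 * (N - 1) + M) \<and> em_b k \<omega> \<in> carrier_vec 2"
    and "\<And>k. k \<ge> 1 \<Longrightarrow> L k = L_o k @\<^sub>r L_b k \<and>
           L_o k \<in> carrier_mat (2 * (N - 1) + M) (N - 1) \<and> L_b k \<in> carrier_mat 2 (N - 1)"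
    and "\<And>k. split_block (P k) (2 * (N - 1) + M) (2 * (N - 1) + M) =
           (P_oo k, P_ob k, P_bo k, P_bb k)"
    and "\<And>k. k \<ge> 1 \<Longrightarrow> split_block (Pm k) (2 * (N - 1) + M) (2 * (N - 1) + M) =
           (Pm_oo k, Pm_ob k, Pm_bo k, Pm_bb k)"
  shows
    "(\<forall>k. P_ob k = transpose_mat (P_bo k)) \<and>
     (\<forall>k\<ge>1. Pm_ob k = transpose_mat (Pm_bo k)) \<and>
     (\<forall>k\<ge>1.
        (\<forall>\<omega>\<in>space \<Omega>.
           em_o k \<omega> @\<^sub>v em_b k \<omega> =
             four_block_mat (A_oo N M \<tau> V) (0\<^sub>m (2 * (N - 1) + M) 2) (A_bo N M \<tau> q) (clock_A \<tau>)
               *\<^sub>v (e_o (k - 1) \<omega> @\<^sub>v e_b (k - 1) \<omega>)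
             + (B_o N M \<tau> V @\<^sub>r B_b \<tau> q) *\<^sub>v u (k - 1) \<omega>) \<and>
        Pm_oo k @\<^sub>r Pm_bo k =
          four_block_mat (A_oo N M \<tau> V) (0\<^sub>m (2 * (N - 1) + M) 2) (A_bo N M \<tau> q) (clock_A \<tau>)
            * (P_oo (k - 1) @\<^sub>r P_bo (k - 1)) * transpose_mat (A_oo N M \<tau> V)
          + (T_o N M V * ens_Q N M \<tau> s1 s2 s3 * transpose_mat (T_o N M V)
             @\<^sub>r T_b M q * ens_Q N M \<tau> s1 s2 s3 * transpose_mat (T_o N M V)) \<and>
        L_o k @\<^sub>r L_b k =
          (Pm_oo k @\<^sub>r Pm_bo k) * transpose_mat (C_o N M)
            * mat_inv (C_o N M * Pm_oo k * transpose_mat (C_o N M) + r \<cdot>\<^sub>m 1\<^sub>m (N - 1)) \<and>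
        P_oo k @\<^sub>r P_bo k =
          (1\<^sub>m (2 * (N - 1) + M) - L_o k * C_o N M) * Pm_oo k
          @\<^sub>r Pm_bo k * (1\<^sub>m (2 * (N - 1) + M) - transpose_mat (C_o N M) * transpose_mat (L_o k)) \<and>
        (\<forall>\<omega>\<in>space \<Omega>.
           e_o k \<omega> @\<^sub>v e_b k \<omega> =
             (em_o k \<omega> @\<^sub>v em_b k \<omega>)
             + (L_o k @\<^sub>r L_b k) *\<^sub>v (y k \<omega> - C_o N M *\<^sub>v em_o k \<omega>)))"
proof -
  let ?n = "2 * (N - 1) + M"
  let ?F = "four_block_mat (A_oo N M \<tau> V) (0\<^sub>m ?n 2) (A_bo N M \<tau> q) (clock_A \<tau>)"
  note filter = assms(18) and e = assms(19) and em = assms(20) and L = assms(21)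
  \<comment> \<open>The subtraction in \<open>N - 1\<close> is harmless because \<open>M < N\<close>
    forces N to be positive. The summand 2 counts the unobservable states.\<close>
  have M_le: "M \<le> N" and dim: "2 * N + M = ?n + 2"
    using assms(2,3) by auto
  note carriers = ensemble_carriers[OF M_le assms(6,14)]
  \<comment> \<open>The matrix recursions do not mention a sample point, but the filter is assumed
    at sample points only. A probability space has at least one.\<close>
  obtain \<omega>0 where \<omega>0: "\<omega>0 \<in> space \<Omega>"
    using prob_space.not_empty[OF assms(1)] by auto
  have W: "T_full N M V q * ens_Q N M \<tau> s1 s2 s3 * transpose_mat (T_full N M V q) =
      (T_o N M V @\<^sub>r T_b M q) * ens_Q N M \<tau> s1 s2 s3 * transpose_mat (T_o N M V @\<^sub>r T_b M q)"
    by (simp only: T_full_def)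
  note blocks = kalman_filter_observable_blocks[OF filter[OF \<omega>0] A_full_def C_full_def W
      carriers(1,2) clock_carriers(1) carriers(3-5) sym_psd_ens_Q[OF M_le assms(4)] assms(5)
      assms(17)[unfolded dim] assms(22,23)]
  have predict: "em_o k \<omega> @\<^sub>v em_b k \<omega> =
      ?F *\<^sub>v (e_o (k - 1) \<omega> @\<^sub>v e_b (k - 1) \<omega>) + (B_o N M \<tau> V @\<^sub>r B_b \<tau> q) *\<^sub>v u (k - 1) \<omega>"
    if "1 \<le> k" "\<omega> \<in> space \<Omega>" for k \<omega>
    using filter[OF that(2)] that(1) em[OF that] e[OF that(2), of "k - 1"]
    by (simp add: kalman_filter_def A_full_def B_full_def)
  have update: "e_o k \<omega> @\<^sub>v e_b k \<omega> = (em_o k \<omega> @\<^sub>v em_b k \<omega>)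
      + (L_o k @\<^sub>r L_b k) *\<^sub>v (y k \<omega> - C_o N M *\<^sub>v em_o k \<omega>)"
    if k: "1 \<le> k" and \<omega>: "\<omega> \<in> space \<Omega>" for k \<omega>
  proof -
    \<comment> \<open>The zero block of the output matrix removes \<open>em_b\<close> from the
      innovation.\<close>
    have "C_full N M *\<^sub>v (em_o k \<omega> @\<^sub>v em_b k \<omega>) = C_o N M *\<^sub>v em_o k \<omega>"
      using em[OF k \<omega>] carriers(3)
      by (simp add: C_full_def append_cols_mult_append_vec[of _ "N - 1" ?n _ 2] zero_mat_mult_vec)
    moreover have "e k \<omega> = em k \<omega> + L k *\<^sub>v (y k \<omega> - C_full N M *\<^sub>v em k \<omega>)"
      using filter[OF \<omega>] k by (simp add: kalman_filter_def)
    ultimately show ?thesis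
      using em[OF k \<omega>] e[OF \<omega>, of k] L[OF k] by simp
  qed
  show ?thesis
  proof (intro conjI allI impI ballI)
    \<comment> \<open>Time 0 is included, where symmetry comes from the assumption on
      \<open>P 0\<close>.\<close>
    show "P_ob k = transpose_mat (P_bo k)" for k
      using L by (intro blocks(1)) auto
    fix k :: nat
    assume k: "1 \<le> k"
    show "Pm_ob k = transpose_mat (Pm_bo k)"
      using L k by (intro blocks(2)) auto
    show "Pm_oo k @\<^sub>r Pm_bo k = ?F * (P_oo (k - 1) @\<^sub>r P_bo (k - 1)) * transpose_mat (A_oo N M \<tau> V)
        + (T_o N M V * ens_Q N M \<tau> s1 s2 s3 * transpose_mat (T_o N M V)
           @\<^sub>r T_b M q * ens_Q N M \<tau> s1 s2 s3 * transpose_mat (T_o N M V))"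
      using L k by (intro blocks(3)[unfolded A_full_def]) auto
    show "L_o k @\<^sub>r L_b k = (Pm_oo k @\<^sub>r Pm_bo k) * transpose_mat (C_o N M)
        * mat_inv (C_o N M * Pm_oo k * transpose_mat (C_o N M) + r \<cdot>\<^sub>m 1\<^sub>m (N - 1))"
      using L k by (intro blocks(4)) auto
    show "P_oo k @\<^sub>r P_bo k = (1\<^sub>m ?n - L_o k * C_o N M) * Pm_oo k
        @\<^sub>r Pm_bo k * (1\<^sub>m ?n - transpose_mat (C_o N M) * transpose_mat (L_o k))"
      using L k by (intro blocks(5)) auto
  qed (fact predict update)+
qed

end
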